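(* Let $\lambda$ be a partition of rank $\rho$. Then for every $j$ with $2\le j\le\rho+1$, $$\tau_0P_{1j}-\tau_1P_{2j}+\cdots+(-1)^\rho\tau_\rho P_{\rho+1,j}=0,$$ and for $j=1$, $$\tau_0P_{11}-\tau_1P_{21}+\cdots+(-1)^\rho\tau_\rho P_{\rho+1,1}=A_{11}.$$
   Context: A partition $\lambda=(\lambda_1\ge\lambda_2\ge\dots\ge\lambda_\ell>0)$ is identified with its Young diagram $\{(r,s)\colon 1\le r\le \ell,\ 1\le s\le\lambda_r\}$. The rank $\rho$ of $\lambda$ is the largest $k$ with $\lambda_k\ge k$. The extended partition $\lambda^*$ is the diagram of the partition with parts $\lambda^*_1=\lambda_1+1$ and $\lambda^*_r=\lambda_{r-1}+1$ for $2\le r\le\ell+1$. To each square $(i,j)\in\lambda$ associate an indeterminate $x_{ij}$. For $(r,s)\in\lambda^*$ let $\lambda(r,s)$ be the partition consisting of the squares $(u,v)\in\lambda$ with $u\ge r$, $v\ge s$; define $P_{rs}=\sum_{\mu\subseteq\lambda(r,s)}\prod_{(i,j)\in\lambda(r,s)\setminus\mu}x_{ij}$ (sum over partitions $\mu$ contained in $\lambda(r,s)$) and $A_{rs}=\prod_{(i,j)\in\lambda(r,s)}x_{ij}$; empty products equal $1$. For $1\le i\le\rho$ let $R_i$ be the rectangular array with $i$ rows and $\lambda_i-i$ columns whose row $a$ ($1\le a\le i$) is $(a,a+1),(a,a+2),\dots,(a,a+\lambda_i-i)$. Let $X_i$ be the set of subarrays $\alpha$ of $R_i$ whose shape is the vertical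 reflection of a Young diagram justified into the upper right-hand corner of $R_i$; i.e. $\alpha$ consists of the last $k_a$ entries of row $a$ for each $a$, where $\lambda_i-i\ge k_1\ge k_2\ge\dots\ge k_i\ge0$. Put $\Omega_i=\sum_{\alpha\in X_i}\prod_{(a,b)\in\alpha}x_{ab}$, and $\Omega_0=1$. Let $S_0=\emptyset$ and for $1\le i\le\rho$ let $S_i=\{(a,b)\in\lambda\colon 1\le a\le i,\ \lambda_i-i+a<b\le\lambda_a\}$. Set $\tau_i=\Omega_i\prod_{(a,b)\in S_i}x_{ab}$ for $0\le i\le\rho$ (so $\tau_0=1$). *)

theory Defs
  imports Complex_Main "HOL-Library.Poly_Mapping"
begin

section \<open>Partitions and Young diagrams\<close>

type_synonym square = "nat \<times> nat"

definition is_partition :: "nat list \<Rightarrow> bool" where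
  "is_partition l \<longleftrightarrow> sorted_wrt (\<ge>) l \<and> (\<forall>p\<in>set l. 0 < p)"

text \<open>Parts are numbered from 1; \<open>part l r = 0\<close> for \<open>r = 0\<close> and for \<open>r\<close> beyond the length.\<close>

definition part :: "nat list \<Rightarrow> nat \<Rightarrow> nat" where
  "part l r = (if 1 \<le> r \<and> r \<le> length l then l ! (r - 1) else 0)"

definition diagram :: "nat list \<Rightarrow> square set" where
  "diagram l = {(r, s). 1 \<le> r \<and> r \<le> length l \<and> 1 \<le> s \<and> s \<le> part l r}"

text \<open>As \<open>part l 0 = 0\<close>, the number \<open>k = 0\<close> always qualifies, and the empty partition has rank 0.\<close>

definition partition_rank :: "nat list \<Rightarrow> nat" where
  "partition_rank l = (GREATEST k. k \<le> part l k)"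

definition extended :: "nat list \<Rightarrow> nat list" where
  "extended l = (part l 1 + 1) # map (\<lambda>p. p + 1) l"

text \<open>\<open>subdiagram l r s\<close> is \<open>\<lambda>(r,s)\<close>, kept at its position inside the diagram of \<open>l\<close>;
  \<open>diagram_at r s m\<close> is the diagram of \<open>m\<close> moved so that its corner square is \<open>(r,s)\<close>.\<close>

definition subdiagram :: "nat list \<Rightarrow> nat \<Rightarrow> nat \<Rightarrow> square set" where
  "subdiagram l r s = {(u, v) \<in> diagram l. r \<le> u \<and> s \<le> v}"

definition diagram_at :: "nat \<Rightarrow> nat \<Rightarrow> nat list \<Rightarrow> square set" where
  "diagram_at r s m = (\<lambda>(u, v). (r + u - 1, s + v - 1)) ` diagram m"

definition subpartitions :: "nat list \<Rightarrow> nat \<Rightarrow> nat \<Rightarrow> nat list set" where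
  "subpartitions l r s = {m. is_partition m \<and> diagram_at r s m \<subseteq> subdiagram l r s}"


section \<open>The polynomials, for weights in an arbitrary commutative ring\<close>

definition P_poly :: "(square \<Rightarrow> 'a::comm_ring_1) \<Rightarrow> nat list \<Rightarrow> nat \<Rightarrow> nat \<Rightarrow> 'a" where
  "P_poly x l r s = (\<Sum>m\<in>subpartitions l r s. \<Prod>q\<in>subdiagram l r s - diagram_at r s m. x q)"

definition A_poly :: "(square \<Rightarrow> 'a::comm_ring_1) \<Rightarrow> nat list \<Rightarrow> nat \<Rightarrow> nat \<Rightarrow> 'a" where
  "A_poly x l r s = (\<Prod>q\<in>subdiagram l r s. x q)"

text \<open>For \<open>1 \<le> i \<le> partition_rank l\<close>, row \<open>a\<close> of the array \<open>R\<^sub>i\<close> is \<open>(a, a + 1), \<dots>, (a, a + (part l i - i))\<close>.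
  An element of \<open>X_set l i\<close> keeps the last \<open>k a\<close> entries of each row \<open>a\<close>.\<close>

definition X_set :: "nat list \<Rightarrow> nat \<Rightarrow> square set set" where
  "X_set l i = {\<alpha>. \<exists>k :: nat \<Rightarrow> nat.
      (\<forall>a. 1 \<le> a \<and> a \<le> i \<longrightarrow> k a \<le> part l i - i) \<and>
      (\<forall>a b. 1 \<le> a \<and> a \<le> b \<and> b \<le> i \<longrightarrow> k b \<le> k a) \<and>
      \<alpha> = {(a, b). 1 \<le> a \<and> a \<le> i \<and>
               a + (part l i - i) - k a < b \<and> b \<le> a + (part l i - i)}}"

definition Omega_poly :: "(square \<Rightarrow> 'a::comm_ring_1) \<Rightarrow> nat list \<Rightarrow> nat \<Rightarrow> 'a" where
  "Omega_poly x l i = (if i = 0 then 1 else \<Sum>\<alpha>\<in>X_set l i. \<Prod>q\<in>\<alpha>. x q)"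

definition S_set :: "nat list \<Rightarrow> nat \<Rightarrow> square set" where
  "S_set l i = (if i = 0 then {} else
     {(a, b) \<in> diagram l. 1 \<le> a \<and> a \<le> i \<and> part l i - i + a < b \<and> b \<le> part l a})"

definition tau_poly :: "(square \<Rightarrow> 'a::comm_ring_1) \<Rightarrow> nat list \<Rightarrow> nat \<Rightarrow> 'a" where
  "tau_poly x l i = Omega_poly x l i * (\<Prod>q\<in>S_set l i. x q)"


section \<open>Indeterminates\<close>

text \<open>The multivariate polynomial ring over \<open>'k\<close>: a monomial maps each square to its exponent.\<close>

type_synonym 'k square_poly = "(square \<Rightarrow>\<^sub>0 nat) \<Rightarrow>\<^sub>0 'k"

definition indet :: "square \<Rightarrow> 'k::comm_ring_1 square_poly" where
  "indet q = Poly_Mapping.single (Poly_Mapping.single q 1) 1"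


section \<open>Well-definedness\<close>

lemma part_rank: "partition_rank l \<le> part l (partition_rank l)"
  and le_rank: "k \<le> part l k \<Longrightarrow> k \<le> partition_rank l"
proof -
  have bound: "\<forall>k. k \<le> part l k \<longrightarrow> k \<le> length l"
    by (auto simp: part_def)
  show "partition_rank l \<le> part l (partition_rank l)"
    unfolding partition_rank_def by (rule GreatestI_nat[where k = 0 and b = "length l"]) (use bound in auto)
  show "k \<le> partition_rank l" if "k \<le> part l k"
    unfolding partition_rank_def by (rule Greatest_le_nat[where b = "length l"]) (use bound that in auto)
qed

lemma part_mono:
  assumes "is_partition l" "1 \<le> a" "a \<le> b"
  shows "part l b \<le> part l a"
proof (cases "b \<le> length l \<and> a < b")
  case True
  then have "l ! (b - 1) \<le> l ! (a - 1)"
    using assms sorted_wrt_nth_less[of "(\<ge>)" l "a - 1" "b - 1"] by (auto simp: is_partition_def)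
  then show ?thesis using True assms by (auto simp: part_def)
next
  case False
  then show ?thesis using assms by (cases "a = b") (auto simp: part_def)
qed

text \<open>All \<open>P\<^bsub>rs\<^esub>\<close> with \<open>r, s \<le> partition_rank l + 1\<close> are indexed by squares of the extended partition.\<close>

lemma extended_contains:
  assumes "is_partition l" "1 \<le> r" "r \<le> partition_rank l + 1" "1 \<le> s" "s \<le> partition_rank l + 1"
  shows "(r, s) \<in> diagram (extended l)"
proof -
  have len: "partition_rank l \<le> length l"
    using part_rank[of l] by (auto simp: part_def split: if_splits)
  have *: "partition_rank l \<le> part l a" if "1 \<le> a" "a \<le> partition_rank l" for a
    using part_rank[of l] part_mono[OF assms(1) that] by simp
  have "s \<le> part (extended l) r"
  proof (cases "r = 1")
    case True
    then show ?thesis using *[of 1] assms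
      by (cases "partition_rank l = 0") (auto simp: part_def extended_def)
  next
    case False
    then have "part (extended l) r = part l (r - 1) + 1"
      using assms len by (auto simp: part_def extended_def nth_Cons')
    moreover have "1 \<le> r - 1" "r - 1 \<le> partition_rank l" using False assms by auto
    ultimately show ?thesis using *[of "r - 1"] assms by simp
  qed
  then show ?thesis using assms len by (auto simp: diagram_def extended_def)
qed

text \<open>The sums defining \<open>P_poly\<close> and \<open>Omega_poly\<close> are finite, so they are genuine sums.\<close>

lemma finite_diagram [simp]: "finite (diagram l)"
proof -
  have "diagram l \<subseteq> (SIGMA r:{1..length l}. {1..part l r})"
    by (auto simp: diagram_def)
  then show ?thesis by (rule finite_subset) auto
qed

lemma finite_subdiagram [simp]: "finite (subdiagram l r s)"
  by (rule finite_subset[OF _ finite_diagram[of l]]) (auto simp: subdiagram_def)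

lemma finite_subpartitions:
  assumes "1 \<le> r" "1 \<le> s"
  shows "finite (subpartitions l r s)"
proof -
  define N where "N = Max (fst ` diagram l \<union> snd ` diagram l \<union> {0})"
  have N: "u \<le> N \<and> v \<le> N" if "(u, v) \<in> diagram l" for u v
    unfolding N_def using that by (force intro!: Max_ge)
  have "set m \<subseteq> {..N} \<and> length m \<le> N" if m: "m \<in> subpartitions l r s" for m
  proof -
    have sq: "i < length m \<Longrightarrow> 0 < m ! i \<and> Suc i \<le> N \<and> m ! i \<le> N" for i
    proof -
      assume i: "i < length m"
      have pos: "0 < m ! i" using m i by (auto simp: subpartitions_def is_partition_def)
      then have "(Suc i, m ! i) \<in> diagram m" using i by (auto simp: diagram_def part_def)
      then have "(r + Suc i - 1, s + m ! i - 1) \<in> diagram_at r s m"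
        unfolding diagram_at_def by force
      then have "(r + Suc i - 1, s + m ! i - 1) \<in> diagram l"
        using m by (auto simp: subpartitions_def subdiagram_def)
      from N[OF this] show ?thesis using pos assms by auto
    qed
    have "set m \<subseteq> {..N}" using sq by (auto simp: in_set_conv_nth)
    moreover have "length m \<le> N" using sq[of "length m - 1"] by (cases m) auto
    ultimately show ?thesis by simp
  qed
  then have "subpartitions l r s \<subseteq> {m. set m \<subseteq> {..N} \<and> length m \<le> N}" by blast
  then show ?thesis by (rule finite_subset) (rule finite_lists_length_le, simp)
qed

lemma finite_X_set: "finite (X_set l i)"
proof -
  have "X_set l i \<subseteq> Pow ({1..i} \<times> {..i + part l i})" by (auto simp: X_set_def)
  then show ?thesis by (rule finite_subset) simp
qed

end

theory Submission
  imports Defs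
begin

text \<open>
  An element of \<open>X\<^sub>i\<close> together with \<open>S\<^sub>i\<close> cuts row \<open>a \<le> i\<close> of the diagram after column \<open>e a\<close>,
  where \<open>0 < e 1 < \<dots> < e i \<le> \<lambda>\<^sub>i\<close>; the complement of a partition inside \<open>\<lambda>(i + 1, j)\<close> cuts the
  rows \<open>u > i\<close> after columns \<open>e (i + 1) \<ge> e (i + 2) \<ge> \<dots> \<ge> j - 1\<close>. So \<open>\<tau>\<^sub>i P\<^bsub>i+1,j\<^esub>\<close> is a sum over
  sequences that increase strictly up to index \<open>i\<close> and decrease weakly after index \<open>i + 1\<close>.
  Put \<open>e 0 = 0\<close>. The sequences with \<open>e i < e (i + 1)\<close> are those with \<open>e (i + 1) \<ge> e (i + 2)\<close> that
  belong to \<open>i + 1\<close>, so the alternating sum telescopes. At \<open>i = \<rho>\<close> no sequence has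
  \<open>e i < e (i + 1)\<close>, and at \<open>i = 0\<close> the condition \<open>e 0 \<ge> e 1\<close> leaves nothing for \<open>j \<ge> 2\<close> and
  only the zero sequence, of weight \<open>A\<^bsub>11\<^esub>\<close>, for \<open>j = 1\<close>.
\<close>

section \<open>Rows cut at a column, and the families of cut sequences\<close>

definition row_tail :: "(square \<Rightarrow> 'a::comm_ring_1) \<Rightarrow> nat list \<Rightarrow> nat \<Rightarrow> nat \<Rightarrow> 'a" where
  "row_tail x l a c = (\<Prod>b\<in>{c<..part l a}. x (a, b))"

text \<open>The value 0 above index \<open>i\<close> makes each finite sequence a single function.
  With \<open>c 0 = 0\<close>, positivity of \<open>c 1\<close> becomes the first strict
  step.\<close>

definition increasing_cuts :: "nat list \<Rightarrow> nat \<Rightarrow> (nat \<Rightarrow> nat) set" where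
  "increasing_cuts l i = {c. c 0 = 0 \<and> (\<forall>a<i. c a < c (Suc a)) \<and> c i \<le> part l i \<and> (\<forall>a>i. c a = 0)}"

text \<open>Here \<open>s = j - 1\<close> is the column just left of the corner. The cap
  \<open>max (part l u) s\<close> forces the cut \<open>s\<close> in rows that do not reach beyond
  column \<open>s\<close>.\<close>

definition decreasing_cuts :: "nat list \<Rightarrow> nat \<Rightarrow> nat \<Rightarrow> (nat \<Rightarrow> nat) set" where
  "decreasing_cuts l i s = {d. (\<forall>u\<le>i. d u = 0) \<and>
     (\<forall>u>i. s \<le> d u \<and> d u \<le> max (part l u) s \<and> d (Suc u) \<le> d u)}"

text \<open>\<open>e i\<close> and \<open>e (Suc i)\<close> are left uncompared; the telescoping
  splits on their order.\<close>

definition mixed_cuts :: "nat list \<Rightarrow> nat \<Rightarrow> nat \<Rightarrow> (nat \<Rightarrow> nat) set" where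
  "mixed_cuts l i s = {e. e 0 = 0 \<and> (\<forall>a<i. e a < e (Suc a)) \<and> e i \<le> part l i \<and>
     (\<forall>u>i. s \<le> e u \<and> e u \<le> max (part l u) s \<and> e (Suc u) \<le> e u)}"

section \<open>Rank bounds, monotone sequences, partitions from their parts\<close>

lemma part_eq_0: "length l < u \<Longrightarrow> part l u = 0"
  by (simp add: part_def)

lemma rank_le_length: "partition_rank l \<le> length l"
  using part_rank[of l] by (auto simp: part_def split: if_splits)

lemma rank_le_part:
  assumes "is_partition l" "1 \<le> i" "i \<le> partition_rank l"
  shows "partition_rank l \<le> part l i"
  using part_rank[of l] part_mono[OF assms] by simp

text \<open>Each strict step adds at least 1. Started at index 0 this bounds cuts from below; ended
  at \<open>i\<close> it bounds them from above.\<close>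

lemma strict_steps_diff:
  fixes c :: "nat \<Rightarrow> nat"
  assumes "\<forall>a<i. c a < c (Suc a)" "a \<le> b" "b \<le> i"
  shows "c a + (b - a) \<le> c b"
  using assms(2,3)
proof (induction b rule: dec_induct)
  case (step b)
  then show ?case using assms(1) by (auto simp: Suc_diff_le less_eq_Suc_le intro: order.trans)
qed simp

lemma weak_steps_antimono:
  fixes d :: "nat \<Rightarrow> nat"
  assumes "\<forall>u>i. d (Suc u) \<le> d u" "i < u" "u \<le> v"
  shows "d v \<le> d u"
  using assms(3)
proof (induction v rule: dec_induct)
  case (step v)
  then show ?case using assms(1,2) by (meson le_trans less_le_trans)
qed simp

text \<open>Parts in the list are positive, so the length is the number of indices with a nonzero
  part.\<close>

lemma partition_eqI:
  assumes "is_partition m" "is_partition m'" "\<And>k. 1 \<le> k \<Longrightarrow> part m k = part m' k"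
  shows "m = m'"
proof -
  have pos: "0 < part n k \<longleftrightarrow> k \<le> length n" if "is_partition n" "1 \<le> k" for n k
    using that by (auto simp: part_def is_partition_def)
  have "k \<le> length m \<longleftrightarrow> k \<le> length m'" if "1 \<le> k" for k
    using pos[OF assms(1) that] pos[OF assms(2) that] assms(3)[OF that] by simp
  from this[of "length m"] this[of "length m'"] have len: "length m = length m'"
    by (cases "length m"; cases "length m'"; simp)
  show ?thesis
  proof (rule nth_equalityI[OF len])
    fix i assume "i < length m"
    then show "m ! i = m' ! i" using assms(3)[of "Suc i"] len by (simp add: part_def)
  qed
qed

text \<open>The list stops before the first zero of \<open>f\<close>; \<open>N\<close> supplies a
  zero, and monotonicity keeps \<open>f\<close> zero from there on.\<close>

lemma partition_with_parts:
  fixes f :: "nat \<Rightarrow> nat"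
  assumes anti: "\<And>u v. 1 \<le> u \<Longrightarrow> u \<le> v \<Longrightarrow> f v \<le> f u" and "1 \<le> N" "f N = 0"
  obtains m where "is_partition m" "\<And>k. 1 \<le> k \<Longrightarrow> part m k = f k"
proof -
  define n where "n = (LEAST n. f (Suc n) = 0)"
  have ex: "f (Suc (N - 1)) = 0" using assms by simp
  have n: "f (Suc n) = 0" unfolding n_def by (rule LeastI[of _ "N - 1"]) (rule ex)
  have pos: "0 < f (Suc k)" if "k < n" for k
    using not_less_Least[of k "\<lambda>n. f (Suc n) = 0"] that unfolding n_def by simp
  define m where "m = map (\<lambda>k. f (Suc k)) [0..<n]"
  have "is_partition m"
    unfolding is_partition_def m_def
    by (auto simp: sorted_wrt_iff_nth_less intro!: anti pos)
  moreover have "part m k = f k" if "1 \<le> k" for k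
  proof (cases "k \<le> n")
    case True
    then show ?thesis using that nth_upt[of 0 "k - 1" n] by (simp add: part_def m_def)
  next
    case False
    then have "f k \<le> f (Suc n)" by (intro anti) auto
    then show ?thesis using False n by (simp add: part_def m_def)
  qed
  ultimately show ?thesis using that by blast
qed

section \<open>\<open>tau_poly\<close> and \<open>P_poly\<close> as sums over cuts\<close>

lemma prod_row_tail:
  assumes "finite I" "Q = {(a, b). a \<in> I \<and> c a < b \<and> b \<le> part l a}"
  shows "(\<Prod>q\<in>Q. x q) = (\<Prod>a\<in>I. row_tail x l a (c a))"
proof -
  have "Q = (SIGMA a:I. {c a<..part l a})" using assms(2) by auto
  then show ?thesis unfolding row_tail_def using assms(1) by (simp add: prod.Sigma)
qed

text \<open>Row \<open>a\<close> of the array is shifted by \<open>a\<close> columns, which turns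
  the weakly decreasing numbers \<open>k a\<close> of kept entries into strictly increasing cuts.
  \<open>S_set\<close> continues each row to the end of the diagram.\<close>

lemma tau_poly_eq:
  assumes l: "is_partition l" and i: "i \<le> partition_rank l"
  shows "tau_poly x l i = (\<Sum>c\<in>increasing_cuts l i. \<Prod>a\<in>{1..i}. row_tail x l a (c a))"
proof (cases "i = 0")
  case True
  have "increasing_cuts l 0 = {\<lambda>_. 0}"
    by (auto simp: increasing_cuts_def part_def fun_eq_iff) (metis gr0I)
  then show ?thesis using True by (simp add: tau_poly_def Omega_poly_def S_set_def)
next
  case False
  then have i1: "1 \<le> i" by simp
  define M where "M = part l i"
  have iM: "i \<le> M" using rank_le_part[OF l i1 i] i unfolding M_def by simp
  \<comment> \<open>What the cuts leave of the array, whose row \<open>a\<close> ends in column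
    \<open>a + (M - i)\<close>.\<close>
  define A where "A c = {(a, b). 1 \<le> a \<and> a \<le> i \<and> c a < b \<and> b \<le> a + (M - i)}" for c :: "nat \<Rightarrow> nat"
  \<comment> \<open>These bounds make \<open>k a\<close> below an exact difference of at most
    \<open>M - i\<close>.\<close>
  have up: "c a \<le> a + (M - i)" and low: "a \<le> c a" if "c \<in> increasing_cuts l i" "a \<le> i" for c a
  proof -
    have c: "\<forall>a<i. c a < c (Suc a)" "c i \<le> M" "c 0 = 0"
      using that(1) by (auto simp: increasing_cuts_def M_def)
    show "c a \<le> a + (M - i)" using strict_steps_diff[OF c(1), of a i] that(2) c(2) iM by simp
    show "a \<le> c a" using strict_steps_diff[OF c(1), of 0 a] that(2) c(3) by simp
  qed
  have inj: "inj_on A (increasing_cuts l i)"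
  proof (rule inj_onI, rule ext)
    fix c c' a assume c: "c \<in> increasing_cuts l i" "c' \<in> increasing_cuts l i" and eq: "A c = A c'"
    show "c a = c' a"
    proof (cases "1 \<le> a \<and> a \<le> i")
      case True
      have "c a < b \<and> b \<le> a + (M - i) \<longleftrightarrow> c' a < b \<and> b \<le> a + (M - i)" for b
        using eq True unfolding A_def set_eq_iff by auto
      \<comment> \<open>The columns tested are the first ones right of each cut.\<close>
      from this[of "Suc (c a)"] this[of "Suc (c' a)"] show ?thesis
        using up[OF c(1), of a] up[OF c(2), of a] True by auto
    next
      case False
      then show ?thesis using c by (cases "a = 0") (auto simp: increasing_cuts_def)
    qed
  qed
  have img: "X_set l i = A ` increasing_cuts l i"
  proof (intro equalityI subsetI)
    fix \<alpha> assume "\<alpha> \<in> X_set l i"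
    then obtain k where k: "\<And>a. 1 \<le> a \<Longrightarrow> a \<le> i \<Longrightarrow> k a \<le> M - i"
      "\<And>a b. 1 \<le> a \<Longrightarrow> a \<le> b \<Longrightarrow> b \<le> i \<Longrightarrow> k b \<le> k a"
      and \<alpha>: "\<alpha> = {(a, b). 1 \<le> a \<and> a \<le> i \<and> a + (M - i) - k a < b \<and> b \<le> a + (M - i)}"
      unfolding X_set_def M_def by blast
    define c where "c a = (if 1 \<le> a \<and> a \<le> i then a + (M - i) - k a else 0)" for a
    \<comment> \<open>For \<open>a = 0\<close> this is \<open>0 < c 1\<close>, which amounts to
      \<open>k 1 \<le> M - i\<close>.\<close>
    have "c a < c (Suc a)" if "a < i" for a
      using that k(1)[of a] k(1)[of "Suc a"] k(2)[of a "Suc a"] by (cases "a = 0") (auto simp: c_def)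
    then have "c \<in> increasing_cuts l i"
      using iM unfolding increasing_cuts_def by (auto simp: c_def M_def)
    moreover have "\<alpha> = A c" unfolding \<alpha> A_def c_def by auto
    ultimately show "\<alpha> \<in> A ` increasing_cuts l i" by blast
  next
    fix \<alpha> assume "\<alpha> \<in> A ` increasing_cuts l i"
    then obtain c where c: "c \<in> increasing_cuts l i" and \<alpha>: "\<alpha> = A c" by blast
    define k where "k a = a + (M - i) - c a" for a
    have "k a \<le> M - i" if "1 \<le> a" "a \<le> i" for a using low[OF c that(2)] by (simp add: k_def)
    moreover have "k b \<le> k a" if "1 \<le> a" "a \<le> b" "b \<le> i" for a b
    proof -
      have "c a + (b - a) \<le> c b"
        using strict_steps_diff[of i c a b] c that by (auto simp: increasing_cuts_def)
      then show ?thesis using that by (simp add: k_def)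
    qed
    moreover have "\<alpha> = {(a, b). 1 \<le> a \<and> a \<le> i \<and> a + (M - i) - k a < b \<and> b \<le> a + (M - i)}"
    proof -
      have "a + (M - i) - k a = c a" if "a \<le> i" for a using up[OF c that] by (simp add: k_def)
      then show ?thesis unfolding \<alpha> A_def by auto
    qed
    ultimately show "\<alpha> \<in> X_set l i" unfolding X_set_def M_def by blast
  qed
  have weight: "(\<Prod>q\<in>A c. x q) * (\<Prod>q\<in>S_set l i. x q) = (\<Prod>a\<in>{1..i}. row_tail x l a (c a))"
    if c: "c \<in> increasing_cuts l i" for c
  proof -
    have fin: "finite (A c)" "finite (S_set l i)"
      using finite_X_set[of l i] img c
      by (auto simp: A_def S_set_def i1 intro: finite_subset[of _ "{1..i} \<times> {..i + M}"]
          finite_subset[OF _ finite_diagram[of l]])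
    have disj: "A c \<inter> S_set l i = {}" by (auto simp: A_def S_set_def M_def)
    have "A c \<union> S_set l i = {(a, b). a \<in> {1..i} \<and> c a < b \<and> b \<le> part l a}"
    proof -
      \<comment> \<open>The array lies inside the diagram, so \<open>S_set\<close> takes over
        exactly where its rows end.\<close>
      have "a + (M - i) \<le> part l a" if "1 \<le> a" "a \<le> i" for a
        using part_mono[OF l that] that iM unfolding M_def by simp
      moreover have "i \<le> length l" using i rank_le_length[of l] by simp
      ultimately show ?thesis using up[OF c] i1 False
        by (fastforce simp: A_def S_set_def diagram_def M_def)
    qed
    then show ?thesis
      using prod.union_disjoint[OF fin disj, of x] prod_row_tail[of "{1..i}" _ c l x] by simp
  qed
  have "tau_poly x l i = (\<Sum>c\<in>increasing_cuts l i. (\<Prod>q\<in>A c. x q) * (\<Prod>q\<in>S_set l i. x q))"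
    using False by (simp add: tau_poly_def Omega_poly_def img sum.reindex[OF inj] sum_distrib_right)
  then show ?thesis using weight by simp
qed

lemma mem_diagram_at:
  "(u, v) \<in> diagram_at (Suc i) (Suc s) m \<longleftrightarrow> i < u \<and> s < v \<and> v \<le> s + part m (u - i)"
proof
  assume R: "i < u \<and> s < v \<and> v \<le> s + part m (u - i)"
  then have "(u - i, v - s) \<in> diagram m" by (auto simp: diagram_def part_def split: if_splits)
  moreover have "(u, v) = (\<lambda>(u, v). (Suc i + u - 1, Suc s + v - 1)) (u - i, v - s)" using R by simp
  ultimately show "(u, v) \<in> diagram_at (Suc i) (Suc s) m" unfolding diagram_at_def by blast
qed (auto simp: diagram_at_def diagram_def)

lemma mem_subdiagram:
  "(u, v) \<in> subdiagram l (Suc i) (Suc s) \<longleftrightarrow> i < u \<and> s < v \<and> v \<le> part l u"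
  by (auto simp: subdiagram_def diagram_def part_def)

text \<open>A partition placed at the corner is recorded by the last columns of its rows; the
  squares beyond them form its complement.\<close>

lemma P_poly_eq:
  assumes l: "is_partition l"
  shows "P_poly x l (Suc i) (Suc s) =
    (\<Sum>d\<in>decreasing_cuts l i s. \<Prod>a\<in>{i<..length l}. row_tail x l a (d a))"
proof -
  \<comment> \<open>An empty row of \<open>m\<close> gets the value \<open>s\<close>, the column
    left of the corner.\<close>
  define F where "F m u = (if u \<le> i then 0 else s + part m (u - i))" for m u
  let ?S = "subpartitions l (Suc i) (Suc s)"
  have inj: "inj_on F ?S"
  proof (rule inj_onI)
    fix m m' assume m: "m \<in> ?S" "m' \<in> ?S" and eq: "F m = F m'"
    show "m = m'"
    proof (rule partition_eqI)
      fix k :: nat assume "1 \<le> k"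
      then show "part m k = part m' k" using fun_cong[OF eq, of "i + k"] by (simp add: F_def)
    qed (use m in \<open>auto simp: subpartitions_def\<close>)
  qed
  have sub: "diagram_at (Suc i) (Suc s) m \<subseteq> subdiagram l (Suc i) (Suc s) \<longleftrightarrow>
      (\<forall>u>i. s + part m (u - i) \<le> max (part l u) s)" (is "?L \<longleftrightarrow> ?R") for m
  proof
    assume L: ?L
    show ?R
    proof (intro allI impI)
      fix u assume "i < u"
      then show "s + part m (u - i) \<le> max (part l u) s"
        \<comment> \<open>The witness is the last square of \<open>m\<close> in row
          \<open>u\<close>; an empty row only needs \<open>s \<le> max (part l u) s\<close>.\<close>
        using subsetD[OF L, of "(u, s + part m (u - i))"]
        by (cases "part m (u - i) = 0") (auto simp: mem_diagram_at mem_subdiagram)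
    qed
  next
    assume R: ?R
    show ?L
    proof (rule subrelI)
      fix u v assume "(u, v) \<in> diagram_at (Suc i) (Suc s) m"
      then show "(u, v) \<in> subdiagram l (Suc i) (Suc s)"
        using R[rule_format, of u] by (auto simp: mem_diagram_at mem_subdiagram le_max_iff_disj)
    qed
  qed
  have img: "F ` ?S = decreasing_cuts l i s"
  proof (intro equalityI subsetI)
    fix d assume "d \<in> F ` ?S"
    then obtain m where m: "is_partition m" "\<forall>u>i. s + part m (u - i) \<le> max (part l u) s"
      and d: "d = F m" by (auto simp: subpartitions_def sub)
    have "part m (Suc u - i) \<le> part m (u - i)" if "i < u" for u
      using part_mono[OF m(1), of "u - i" "Suc u - i"] that by simp
    then show "d \<in> decreasing_cuts l i s" using m(2) by (auto simp: d F_def decreasing_cuts_def)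
  next
    fix d assume d: "d \<in> decreasing_cuts l i s"
    obtain m where m: "is_partition m" "\<And>k. 1 \<le> k \<Longrightarrow> part m k = d (i + k) - s"
    proof (rule partition_with_parts[of "\<lambda>k. d (i + k) - s" "Suc (length l)"])
      show "d (i + v) - s \<le> d (i + u) - s" if "1 \<le> u" "u \<le> v" for u v
        using weak_steps_antimono[of i d "i + u" "i + v"] d that
        by (auto simp: decreasing_cuts_def intro!: diff_le_mono)
      \<comment> \<open>This row lies below the diagram, so its cut is \<open>s\<close> and the
        required zero exists.\<close>
      have "d (i + Suc (length l)) \<le> max (part l (i + Suc (length l))) s"
        using d by (simp add: decreasing_cuts_def)
      then show "d (i + Suc (length l)) - s = 0" by (simp add: part_eq_0)
    qed auto
    have s: "s \<le> d u" if "i < u" for u using d that by (auto simp: decreasing_cuts_def)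
    have "d = F m"
    proof
      fix u show "d u = F m u"
        using d m(2)[of "u - i"] s[of u] by (cases "u \<le> i") (auto simp: F_def decreasing_cuts_def)
    qed
    moreover have "m \<in> ?S"
      using m d s by (auto simp: subpartitions_def sub decreasing_cuts_def)
    ultimately show "d \<in> F ` ?S" by blast
  qed
  have weight: "(\<Prod>q\<in>subdiagram l (Suc i) (Suc s) - diagram_at (Suc i) (Suc s) m. x q) =
      (\<Prod>a\<in>{i<..length l}. row_tail x l a (F m a))" for m
  proof (rule prod_row_tail)
    have "u \<le> length l" if "v \<le> part l u" "s < v" for u v
      using that part_eq_0[of l u] by linarith
    then show "subdiagram l (Suc i) (Suc s) - diagram_at (Suc i) (Suc s) m =
        {(a, b). a \<in> {i<..length l} \<and> F m a < b \<and> b \<le> part l a}"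
      by (auto simp: mem_diagram_at mem_subdiagram F_def)
  qed simp
  show ?thesis unfolding P_poly_def weight img[symmetric] sum.reindex[OF inj] by simp
qed

section \<open>The products \<open>tau_poly\<close> times \<open>P_poly\<close> as sums over mixed
  cuts\<close>

lemma finite_mixed_cuts: "finite (mixed_cuts l i s)"
proof -
  let ?N = "Max (part l ` {..length l})"
  have part_le: "part l a \<le> ?N" for a
    by (cases "a \<le> length l") (auto simp: part_eq_0)
  \<comment> \<open>Below the diagram the cut can only be \<open>s\<close>, which serves as the
    default value of a finite set of functions.\<close>
  have "mixed_cuts l i s \<subseteq> {e. \<forall>a. (a \<in> {..i + length l} \<longrightarrow> e a \<in> {..?N + s}) \<and>
      (a \<notin> {..i + length l} \<longrightarrow> e a = s)}"
  proof (intro subsetI CollectI allI conjI impI)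
    fix e a assume e: "e \<in> mixed_cuts l i s"
    then have up: "a \<le> i \<Longrightarrow> e a \<le> e i"
      using strict_steps_diff[of i e a i] by (auto simp: mixed_cuts_def)
    have "e a \<le> max (part l a) s" if "i < a" using e that by (auto simp: mixed_cuts_def)
    moreover have "e i \<le> part l i" using e by (auto simp: mixed_cuts_def)
    ultimately show "e a \<in> {..?N + s}"
      using up part_le[of a] part_le[of i] by (cases "a \<le> i") auto
    show "e a = s" if "a \<notin> {..i + length l}"
    proof -
      have "s \<le> e a" "e a \<le> max (part l a) s" using e that by (auto simp: mixed_cuts_def)
      then show ?thesis using that by (simp add: part_eq_0)
    qed
  qed
  then show ?thesis by (rule finite_subset) (intro finite_set_of_finite_funs; simp)
qed

text \<open>Gluing at index \<open>i\<close> is a bijection because no condition links the two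
  halves. The rank bound gives \<open>i \<le> length l\<close>, so the row ranges fit
  together.\<close>

lemma tau_mult_P_poly:
  assumes l: "is_partition l" and i: "i \<le> partition_rank l"
  shows "tau_poly x l i * P_poly x l (Suc i) (Suc s) =
    (\<Sum>e\<in>mixed_cuts l i s. \<Prod>a\<in>{1..length l}. row_tail x l a (e a))"
proof -
  let ?C = "increasing_cuts l i" and ?D = "decreasing_cuts l i s"
  let ?g = "\<lambda>(c, d) a. if a \<le> i then c a else d a :: nat"
  let ?h = "\<lambda>e :: nat \<Rightarrow> nat. (\<lambda>a. if a \<le> i then e a else 0, \<lambda>a. if a \<le> i then 0 else e a)"
  have split: "{1..length l} = {1..i} \<union> {i<..length l}"
    using i rank_le_length[of l] by auto
  have "tau_poly x l i * P_poly x l (Suc i) (Suc s) =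
      (\<Sum>(c, d)\<in>?C \<times> ?D. (\<Prod>a\<in>{1..i}. row_tail x l a (c a)) *
        (\<Prod>a\<in>{i<..length l}. row_tail x l a (d a)))"
    by (simp add: tau_poly_eq[OF l i] P_poly_eq[OF l] sum_product sum.cartesian_product)
  also have "\<dots> = (\<Sum>e\<in>mixed_cuts l i s. \<Prod>a\<in>{1..length l}. row_tail x l a (e a))"
  proof (rule sum.reindex_bij_witness[where i = ?h and j = ?g])
    fix p assume "p \<in> ?C \<times> ?D"
    then obtain c d where p: "p = (c, d)" "c \<in> ?C" "d \<in> ?D" by blast
    show "?h (?g p) = p"
      using p by (auto simp: fun_eq_iff increasing_cuts_def decreasing_cuts_def)
    show "?g p \<in> mixed_cuts l i s"
      using p by (auto simp: increasing_cuts_def decreasing_cuts_def mixed_cuts_def)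
    show "(\<Prod>a\<in>{1..length l}. row_tail x l a (?g p a)) =
        (case p of (c, d) \<Rightarrow> (\<Prod>a\<in>{1..i}. row_tail x l a (c a)) *
          (\<Prod>a\<in>{i<..length l}. row_tail x l a (d a)))"
      unfolding split p(1) by (subst prod.union_disjoint) auto
  next
    fix e assume e: "e \<in> mixed_cuts l i s"
    show "?g (?h e) = e" by auto
    show "?h e \<in> ?C \<times> ?D"
      using e by (auto simp: increasing_cuts_def decreasing_cuts_def mixed_cuts_def)
  qed
  finally show ?thesis .
qed

section \<open>Cancellation and the two boundary terms\<close>

text \<open>Neighbouring terms cancel through this equality. The rank bounds give
  \<open>s \<le> part l (Suc i)\<close>, so the cap on \<open>e (Suc i)\<close> is the same on both
  sides.\<close>

lemma mixed_cuts_ascent_eq: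
  assumes l: "is_partition l" and i: "i < partition_rank l" and s: "s \<le> partition_rank l"
  shows "{e \<in> mixed_cuts l i s. e i < e (Suc i)} =
    {e \<in> mixed_cuts l (Suc i) s. \<not> e (Suc i) < e (Suc (Suc i))}" (is "?F = ?B")
proof (intro equalityI subsetI)
  have max: "max (part l (Suc i)) s = part l (Suc i)"
    using rank_le_part[OF l, of "Suc i"] i s by simp
  fix e
  {
    assume "e \<in> ?F"
    then show "e \<in> ?B"
      using max by (auto simp: mixed_cuts_def less_Suc_eq)
  next
    assume "e \<in> ?B"
    then have e: "e 0 = 0" "\<forall>a<Suc i. e a < e (Suc a)" "e (Suc i) \<le> part l (Suc i)"
      "\<forall>u>Suc i. s \<le> e u \<and> e u \<le> max (part l u) s \<and> e (Suc u) \<le> e u" "e (Suc (Suc i)) \<le> e (Suc i)"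
      by (auto simp: mixed_cuts_def)
    \<comment> \<open>Membership for \<open>Suc i\<close> puts no lower bound \<open>s\<close> on
      \<open>e (Suc i)\<close>; it is inherited from the next cut.\<close>
    have "s \<le> e (Suc (Suc i))" using e(4) by blast
    then have "s \<le> e u \<and> e u \<le> max (part l u) s \<and> e (Suc u) \<le> e u" if "i < u" for u
      using e(3-5) that by (cases "u = Suc i") auto
    \<comment> \<open>As \<open>part l 0 = 0\<close>, monotonicity of the parts does not cover
      \<open>i = 0\<close>; there \<open>e 0 = 0\<close> suffices.\<close>
    moreover have "e i \<le> part l i"
    proof (cases "i = 0")
      case False
      moreover have "e i < e (Suc i)" using e(2) by simp
      ultimately show ?thesis using e(3) part_mono[OF l, of i "Suc i"] by simp
    qed (simp add: e)
    ultimately show "e \<in> ?F" using e by (auto simp: mixed_cuts_def)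
  }
qed

text \<open>Strict steps from 0 push the cut at the rank up to at least the rank, while maximality
  of the rank and the bound on \<open>s\<close> keep the next cut at most there.\<close>

lemma mixed_cuts_rank_no_ascent:
  assumes s: "s \<le> partition_rank l" and e: "e \<in> mixed_cuts l (partition_rank l) s"
  shows "\<not> e (partition_rank l) < e (Suc (partition_rank l))"
proof -
  let ?r = "partition_rank l"
  have "?r \<le> e ?r"
    using strict_steps_diff[of ?r e 0 ?r] e by (auto simp: mixed_cuts_def)
  moreover have "part l (Suc ?r) \<le> ?r" using le_rank[of "Suc ?r" l] by force
  moreover have "e (Suc ?r) \<le> max (part l (Suc ?r)) s" using e by (auto simp: mixed_cuts_def)
  ultimately show ?thesis using s by simp
qed

text \<open>Without an ascent \<open>e 1 = 0\<close>, so weak decrease kills all later cuts, and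
  \<open>s \<le> e 1\<close> leaves only \<open>s = 0\<close>.\<close>

lemma mixed_cuts_0_descent:
  "{e \<in> mixed_cuts l 0 s. \<not> e 0 < e (Suc 0)} = (if s = 0 then {\<lambda>_. 0} else {})"
proof -
  have zero: "s = 0 \<and> e = (\<lambda>_. 0)" if e: "e \<in> mixed_cuts l 0 s" "\<not> e 0 < e (Suc 0)" for e
  proof -
    have *: "e 0 = 0" "e (Suc 0) = 0" "\<forall>u>0. s \<le> e u" "\<forall>u>0. e (Suc u) \<le> e u"
      using e by (auto simp: mixed_cuts_def)
    have "e u = 0" for u
      using weak_steps_antimono[OF *(4), of "Suc 0" u] *(1,2) by (cases u) auto
    moreover have "s \<le> e (Suc 0)" using *(3) by blast
    ultimately show ?thesis using *(2) by auto
  qed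
  show ?thesis
  proof (intro equalityI subsetI)
    fix e assume "e \<in> {e \<in> mixed_cuts l 0 s. \<not> e 0 < e (Suc 0)}"
    then show "e \<in> (if s = 0 then {\<lambda>_. 0} else {})" using zero[of e] by simp
  qed (auto simp: mixed_cuts_def split: if_splits)
qed

lemma alternating_sum_telescope:
  fixes f b :: "nat \<Rightarrow> 'a::comm_ring_1"
  assumes "\<And>i. i < n \<Longrightarrow> f i = b (Suc i)"
  shows "(\<Sum>i = 0..n. (-1) ^ i * (f i + b i)) = b 0 + (-1) ^ n * f n"
  using assms by (induction n) (simp_all add: algebra_simps)

text \<open>Covers both identities of the theorem, with \<open>s = j - 1\<close>.\<close>

lemma alternating_tau_P_sum:
  assumes l: "is_partition l" and s: "s \<le> partition_rank l"
  shows "(\<Sum>i = 0..partition_rank l. (-1) ^ i * tau_poly x l i * P_poly x l (i + 1) (Suc s)) =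
    (if s = 0 then A_poly x l 1 1 else 0)"
proof -
  let ?r = "partition_rank l"
  define W where "W e = (\<Prod>a\<in>{1..length l}. row_tail x l a (e a))" for e
  \<comment> \<open>\<open>f i\<close> cancels against \<open>b (Suc i)\<close>, so only
    \<open>b 0\<close> and \<open>f\<close> at the rank survive.\<close>
  define f where "f i = sum W {e \<in> mixed_cuts l i s. e i < e (Suc i)}" for i
  define b where "b i = sum W {e \<in> mixed_cuts l i s. \<not> e i < e (Suc i)}" for i
  have "tau_poly x l i * P_poly x l (i + 1) (Suc s) = f i + b i" if "i \<le> ?r" for i
  proof -
    have "mixed_cuts l i s = {e \<in> mixed_cuts l i s. e i < e (Suc i)} \<union>
        {e \<in> mixed_cuts l i s. \<not> e i < e (Suc i)}" by blast
    then have "sum W (mixed_cuts l i s) = f i + b i"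
      unfolding f_def b_def
      by (subst sum.union_disjoint[symmetric]) (auto simp: finite_mixed_cuts)
    then show ?thesis using tau_mult_P_poly[OF l that, of x s] by (simp add: W_def)
  qed
  then have "(\<Sum>i = 0..?r. (-1) ^ i * tau_poly x l i * P_poly x l (i + 1) (Suc s)) =
      (\<Sum>i = 0..?r. (-1) ^ i * (f i + b i))"
    by (intro sum.cong) (auto simp: mult.assoc)
  also have "\<dots> = b 0 + (-1) ^ ?r * f ?r"
    by (rule alternating_sum_telescope) (simp add: f_def b_def mixed_cuts_ascent_eq[OF l _ s])
  also have "f ?r = 0"
    using mixed_cuts_rank_no_ascent[OF s] unfolding f_def by (intro sum.neutral) blast
  also have "b 0 = (if s = 0 then W (\<lambda>_. 0) else 0)"
    by (simp add: b_def mixed_cuts_0_descent)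
  \<comment> \<open>Zero cuts leave every row whole.\<close>
  also have "W (\<lambda>_. 0) = A_poly x l 1 1"
    unfolding W_def A_poly_def
    by (rule prod_row_tail[symmetric]) (auto simp: subdiagram_def diagram_def)
  finally show ?thesis by simp
qed

theorem theorem2:
  fixes l :: "nat list" and x :: "square \<Rightarrow> 'k::comm_ring_1 square_poly"
  assumes "is_partition l" and "x = indet"
  shows "(\<forall>j. 2 \<le> j \<and> j \<le> partition_rank l + 1 \<longrightarrow>
            (\<Sum>i = 0..partition_rank l. (-1) ^ i * tau_poly x l i * P_poly x l (i + 1) j) = 0) \<and>
         (\<Sum>i = 0..partition_rank l. (-1) ^ i * tau_poly x l i * P_poly x l (i + 1) 1) = A_poly x l 1 1"
proof (intro conjI allI impI)
  fix j assume j: "2 \<le> j \<and> j \<le> partition_rank l + 1"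
  then have "j = Suc (j - 1)" "j - 1 \<le> partition_rank l" "j - 1 \<noteq> 0" by auto
  then show "(\<Sum>i = 0..partition_rank l. (-1) ^ i * tau_poly x l i * P_poly x l (i + 1) j) = 0"
    using alternating_tau_P_sum[OF assms(1), of "j - 1" x] by simp
next
  show "(\<Sum>i = 0..partition_rank l. (-1) ^ i * tau_poly x l i * P_poly x l (i + 1) 1) = A_poly x l 1 1"
    using alternating_tau_P_sum[OF assms(1), of 0 x] by simp
qed

end
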